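(* For every real $\alpha\ge 1$ and every decidable parameterized optimization problem $\Pi$, $\Pi$ admits a polynomial time $\alpha$-approximation algorithm if and only if $\Pi$ has an $\alpha$-approximate kernel of constant size.
   Context: A parameterized optimization problem (minimization or maximization) is a computable function $\Pi:\Sigma^*\times\mathbb{N}\times\Sigma^*\to\mathbb{R}\cup\{\pm\infty\}$, $\Sigma$ a finite alphabet. Instances are pairs $(I,k)$; a solution to $(I,k)$ is any $s\in\Sigma^*$ with $|s|\le|I|+k$, of value $\Pi(I,k,s)$; $OPT(I,k)$ is the minimum (resp. maximum) value over all solutions. $\Pi$ is decidable if some algorithm outputs an optimal solution on every instance. A polynomial time $\alpha$-approximation algorithm outputs in polynomial time a solution $s$ with $\Pi(I,k,s)\le\alpha\cdot OPT(I,k)$ (minimization) or $\alpha\cdot\Pi(I,k,s)\ge OPT(I,k)$ (maximization). An $\alpha$-approximate polynomial time pre-processing algorithm for $\Pi$ is a pair of polynomial time algorithms: a reduction algorithm computing $(I,k)\mapsto(I',k')$ (instances of $\Pi$), and a solution lifting algorithm that, given $(I,k)$, $(I',k')$ and a solution $s'$ to $(I',k')$, runs in time polynomial in $|I|,k,|I'|,k',|s'|$ and outputs a solution $s$ to $(I,k)$ with $\frac{\Pi(I,k,s)}{OPT(I,k)}\le\alpha\cdot\frac{\Pi(I',k',s')}{OPT(I',k')}$ (minimization) or $\frac{\Pi(I,k,s)}{OPT(I,k)}\cdot\alpha\ge\frac{\Pi(I',k',s')}{OPT(I',k')}$ (maximization). Its size is $\mathrm{size}(k)=\sup\{|I'|+k'\}$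 over all outputs of the reduction algorithm on inputs with parameter $k$. An $\alpha$-approximate kernel of constant size is such an algorithm whose size is bounded by a constant.
   Formalization: Adds the assumption that OPT(I,k) ≥ 0 on every instance (−∞ also allowed when maximizing); without it the claim fails, e.g. Π ≡ −1, minimization, α = 2 has a constant size kernel but no α-approximation. A solution of optimal value is given ratio Π/OPT = 1, also for 0/0 and ∞/∞. *)

theory Defs
  imports "HOL-Library.Extended_Real" "HOL-Computational_Algebra.Polynomial"
begin

section \<open>Algorithms: deterministic multi-tape Turing machines\<close>

text \<open>
  The input alphabet is the finite type \<open>'a\<close>. Besides its letters, a tape cell can hold a blank,
  the digit \<open>Tick\<close> of unary numbers, or one of the machine's own auxiliary symbols.
\<close>

datatype 'a sym = Blank | Letter 'a | Tick | Aux nat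

datatype dir = GoLeft | Stay | GoRight

fun shift :: "dir \<Rightarrow> int" where
  "shift GoLeft = -1"
| "shift Stay = 0"
| "shift GoRight = 1"

text \<open>
  A machine has finitely many tapes, states \<open>{..<nstates M}\<close> and symbols \<open>alphabet M\<close>, so the
  relevant part of \<open>trans\<close> is a finite table. A transition to \<open>None\<close> means that the machine halts.
\<close>

record 'a tm =
  ntapes :: nat
  nstates :: nat
  naux :: nat
  trans :: "nat \<Rightarrow> (nat \<Rightarrow> 'a sym) \<Rightarrow> (nat \<times> (nat \<Rightarrow> 'a sym \<times> dir)) option"

definition alphabet :: "'a tm \<Rightarrow> 'a sym set" where
  "alphabet M = {Blank, Tick} \<union> range Letter \<union> Aux ` {..<naux M}"

definition is_tm :: "'a tm \<Rightarrow> bool" where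
  "is_tm M \<longleftrightarrow> 0 < nstates M \<and>
     (\<forall>q r q' act. q < nstates M \<longrightarrow> range r \<subseteq> alphabet M \<longrightarrow> trans M q r = Some (q', act) \<longrightarrow>
        q' < nstates M \<and> (\<forall>i < ntapes M. fst (act i) \<in> alphabet M))"

text \<open>A tape is two-way infinite and consists of the head position and the cell contents.\<close>

type_synonym 'a tape = "int \<times> (int \<Rightarrow> 'a sym)"

type_synonym 'a config = "nat \<times> (nat \<Rightarrow> 'a tape)"

definition scan :: "'a tape \<Rightarrow> 'a sym" where
  "scan t = snd t (fst t)"

definition update_tape :: "'a sym \<times> dir \<Rightarrow> 'a tape \<Rightarrow> 'a tape" where
  "update_tape a t = (fst t + shift (snd a), (snd t)(fst t := fst a))"

definition scanned :: "'a tm \<Rightarrow> (nat \<Rightarrow> 'a tape) \<Rightarrow> nat \<Rightarrow> 'a sym" where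
  "scanned M T = (\<lambda>i. if i < ntapes M then scan (T i) else Blank)"

definition halted :: "'a tm \<Rightarrow> 'a config \<Rightarrow> bool" where
  "halted M c \<longleftrightarrow> trans M (fst c) (scanned M (snd c)) = None"

text \<open>Halted configurations do not change any more.\<close>

definition step :: "'a tm \<Rightarrow> 'a config \<Rightarrow> 'a config" where
  "step M c = (case trans M (fst c) (scanned M (snd c)) of
       None \<Rightarrow> c
     | Some (q', act) \<Rightarrow>
         (q', \<lambda>i. if i < ntapes M then update_tape (act i) (snd c i) else snd c i))"

definition tape_of :: "'a sym list \<Rightarrow> 'a tape" where
  "tape_of xs = (0, \<lambda>z. if 0 \<le> z \<and> z < int (length xs) then xs ! nat z else Blank)"

definition init :: "'a sym list list \<Rightarrow> 'a config" where
  "init xss = (0, \<lambda>i. if i < length xss then tape_of (xss ! i) else tape_of [])"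

text \<open>
  \<open>computes_within M xss yss t\<close>: started with the strings \<open>xss\<close> on the first tapes and all other
  tapes empty, \<open>M\<close> halts after at most \<open>t\<close> steps, and then the tapes directly following the
  input tapes contain precisely the strings \<open>yss\<close>, with their heads on the first cell.
\<close>

definition computes_within ::
    "'a tm \<Rightarrow> 'a sym list list \<Rightarrow> 'a sym list list \<Rightarrow> nat \<Rightarrow> bool" where
  "computes_within M xss yss t \<longleftrightarrow>
     halted M ((step M ^^ t) (init xss)) \<and>
     (\<forall>j < length yss. snd ((step M ^^ t) (init xss)) (length xss + j) = tape_of (yss ! j))"

definition str :: "'a list \<Rightarrow> 'a sym list" where
  "str w = map Letter w"

definition unary :: "nat \<Rightarrow> 'a sym list" where
  "unary n = replicate n Tick"


section \<open>Parameterized optimization problems\<close>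

datatype goal = Minimize | Maximize

type_synonym 'a problem = "'a list \<Rightarrow> nat \<Rightarrow> 'a list \<Rightarrow> ereal"

text \<open>
  Computability of an extended real valued function is meant in the usual sense of computable
  analysis: an algorithm produces rational approximations to any requested accuracy \<open>2\<^sup>-\<^sup>n\<close>, and
  recognises infinite values. The output \<open>(a, b, c)\<close> stands for \<open>(a - b) / c\<close>, where for \<open>c = 0\<close>
  the conventions \<open>x / 0 = \<infinity>\<close> for \<open>x > 0\<close> and \<open>x / 0 = - \<infinity>\<close> for \<open>x < 0\<close> of \<open>ereal\<close> apply.
\<close>

definition approximates :: "nat \<Rightarrow> ereal \<Rightarrow> ereal \<Rightarrow> bool" where
  "approximates n q v \<longleftrightarrow> (if \<bar>v\<bar> = \<infinity> then q = v else \<bar>q - v\<bar> \<le> ereal ((1 / 2) ^ n))"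

definition computable_problem :: "'a problem \<Rightarrow> bool" where
  "computable_problem \<Pi> \<longleftrightarrow>
     (\<exists>M. is_tm M \<and>
       (\<forall>I k s n. \<exists>a b c t.
          computes_within M [str I, unary k, str s, unary n] [unary a, unary b, unary c] t \<and>
          approximates n (ereal (real a - real b) / ereal (real c)) (\<Pi> I k s)))"

definition solutions :: "'a list \<Rightarrow> nat \<Rightarrow> 'a list set" where
  "solutions I k = {s. length s \<le> length I + k}"

definition OPT :: "goal \<Rightarrow> ('a::finite) problem \<Rightarrow> 'a list \<Rightarrow> nat \<Rightarrow> ereal" where
  "OPT g \<Pi> I k = (case g of
       Minimize \<Rightarrow> Min (\<Pi> I k ` solutions I k)
     | Maximize \<Rightarrow> Max (\<Pi> I k ` solutions I k))"

definition decidable :: "goal \<Rightarrow> ('a::finite) problem \<Rightarrow> bool" where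
  "decidable g \<Pi> \<longleftrightarrow>
     (\<exists>M. is_tm M \<and>
       (\<forall>I k. \<exists>s t. computes_within M [str I, unary k] [str s] t \<and>
          s \<in> solutions I k \<and> \<Pi> I k s = OPT g \<Pi> I k))"


section \<open>Approximation algorithms and approximate kernels\<close>

definition approx_solution ::
    "real \<Rightarrow> goal \<Rightarrow> ('a::finite) problem \<Rightarrow> 'a list \<Rightarrow> nat \<Rightarrow> 'a list \<Rightarrow> bool" where
  "approx_solution \<alpha> g \<Pi> I k s \<longleftrightarrow> s \<in> solutions I k \<and>
     (case g of
        Minimize \<Rightarrow> \<Pi> I k s \<le> ereal \<alpha> * OPT g \<Pi> I k
      | Maximize \<Rightarrow> ereal \<alpha> * \<Pi> I k s \<ge> OPT g \<Pi> I k)"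

definition has_polytime_approximation :: "real \<Rightarrow> goal \<Rightarrow> ('a::finite) problem \<Rightarrow> bool" where
  "has_polytime_approximation \<alpha> g \<Pi> \<longleftrightarrow>
     (\<exists>M (p :: nat poly). is_tm M \<and>
       (\<forall>I k. \<exists>s. computes_within M [str I, unary k] [str s] (poly p (length I + k)) \<and>
          approx_solution \<alpha> g \<Pi> I k s))"

text \<open>
  The quotient \<open>\<Pi>(I,k,s) / OPT(I,k)\<close>. An optimal solution has ratio 1 also in the indeterminate
  cases \<open>0 / 0\<close> and \<open>\<plusminus>\<infinity> / \<plusminus>\<infinity>\<close>, for which the division of \<open>ereal\<close> would yield 0. For \<open>x \<noteq> 0\<close>,
  \<open>x / 0\<close> is infinite with the sign of \<open>x\<close>.
\<close>

definition ratio :: "goal \<Rightarrow> ('a::finite) problem \<Rightarrow> 'a list \<Rightarrow> nat \<Rightarrow> 'a list \<Rightarrow> ereal" where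
  "ratio g \<Pi> I k s = (if \<Pi> I k s = OPT g \<Pi> I k then 1 else \<Pi> I k s / OPT g \<Pi> I k)"

definition lift_guarantee ::
    "real \<Rightarrow> goal \<Rightarrow> ('a::finite) problem \<Rightarrow> 'a list \<Rightarrow> nat \<Rightarrow> 'a list \<Rightarrow> 'a list \<Rightarrow> nat \<Rightarrow> 'a list \<Rightarrow> bool" where
  "lift_guarantee \<alpha> g \<Pi> I k s I' k' s' \<longleftrightarrow>
     (case g of
        Minimize \<Rightarrow> ratio g \<Pi> I k s \<le> ereal \<alpha> * ratio g \<Pi> I' k' s'
      | Maximize \<Rightarrow> ratio g \<Pi> I k s * ereal \<alpha> \<ge> ratio g \<Pi> I' k' s')"

definition polytime_reduction :: "'a tm \<Rightarrow> ('a list \<Rightarrow> nat \<Rightarrow> 'a list \<times> nat) \<Rightarrow> bool" where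
  "polytime_reduction M red \<longleftrightarrow> is_tm M \<and>
     (\<exists>p :: nat poly. \<forall>I k. case red I k of (I', k') \<Rightarrow>
        computes_within M [str I, unary k] [str I', unary k'] (poly p (length I + k)))"

definition polytime_solution_lifting ::
    "real \<Rightarrow> goal \<Rightarrow> ('a::finite) problem \<Rightarrow> 'a tm \<Rightarrow> ('a list \<Rightarrow> nat \<Rightarrow> 'a list \<times> nat) \<Rightarrow> bool" where
  "polytime_solution_lifting \<alpha> g \<Pi> M red \<longleftrightarrow> is_tm M \<and>
     (\<exists>p :: nat poly. \<forall>I k. case red I k of (I', k') \<Rightarrow>
        \<forall>s' \<in> solutions I' k'. \<exists>s \<in> solutions I k.
          computes_within M [str I, unary k, str I', unary k', str s'] [str s]
            (poly p (length I + k + length I' + k' + length s')) \<and>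
          lift_guarantee \<alpha> g \<Pi> I k s I' k' s')"

text \<open>
  A pre-processing algorithm is a pair of machines \<open>R\<close> and \<open>L\<close>; \<open>red\<close> is the function computed
  by \<open>R\<close>.
\<close>

definition approx_preprocessing ::
    "real \<Rightarrow> goal \<Rightarrow> ('a::finite) problem \<Rightarrow> 'a tm \<Rightarrow> 'a tm \<Rightarrow> ('a list \<Rightarrow> nat \<Rightarrow> 'a list \<times> nat) \<Rightarrow> bool" where
  "approx_preprocessing \<alpha> g \<Pi> R L red \<longleftrightarrow>
     polytime_reduction R red \<and> polytime_solution_lifting \<alpha> g \<Pi> L red"

definition preprocessing_size :: "('a list \<Rightarrow> nat \<Rightarrow> 'a list \<times> nat) \<Rightarrow> nat \<Rightarrow> enat" where
  "preprocessing_size red k = (SUP I. case red I k of (I', k') \<Rightarrow> enat (length I' + k'))"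

definition has_constant_size_approx_kernel :: "real \<Rightarrow> goal \<Rightarrow> ('a::finite) problem \<Rightarrow> bool" where
  "has_constant_size_approx_kernel \<alpha> g \<Pi> \<longleftrightarrow>
     (\<exists>R L red. approx_preprocessing \<alpha> g \<Pi> R L red \<and>
        (\<exists>c :: nat. \<forall>k. preprocessing_size red k \<le> enat c))"

text \<open>
  The inequalities between quotients express approximation quality only if the optimum is not
  negative. If \<open>OPT < 0\<close>, then for minimization every solution satisfies \<open>\<Pi> / OPT \<le> 1\<close> whatever
  its quality, whereas \<open>\<Pi> \<le> \<alpha> * OPT\<close> fails for \<open>\<alpha> > 1\<close>; for the constant problem \<open>\<Pi> = -1\<close> there
  is a constant size kernel but no approximation algorithm. The value \<open>- \<infinity>\<close> is the usual value of
  infeasible solutions to maximization problems and hence is allowed there as an optimum.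
\<close>

definition nonneg_optimum :: "goal \<Rightarrow> ('a::finite) problem \<Rightarrow> bool" where
  "nonneg_optimum g \<Pi> \<longleftrightarrow>
     (\<forall>I k. 0 \<le> OPT g \<Pi> I k \<or> g = Maximize \<and> OPT g \<Pi> I k = - \<infinity>)"

end

theory Submission
  imports Defs
begin

text \<open>
  An approximation algorithm yields a kernel of size 0: every instance is reduced to the empty one,
  whose only solution is optimal, and the lifting algorithm ignores it and runs the approximation.
  Conversely, a kernel of constant size has only finitely many outputs, so a table of optimal
  solutions of these instances fits into the finite control of a machine. Lifting the solution found
  in the table costs at most the factor \<open>\<alpha>\<close>, since the ratio of an optimal solution is 1.
\<close>

section \<open>Executions\<close>

text \<open>The difficulty lies in chaining machines. A machine expects its inputs on the first
  tapes and blanks elsewhere, and it may leave arbitrary contents on all tapes but its output tapes.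
  Instead of cleaning up, everything happens inside one machine with enough tapes: an injective
  renaming gives each component work tapes of its own, and an output tape of one component serves as
  an input tape of the next. All components thereby share a tape count and an auxiliary alphabet, so
  that a few control-flow combinators suffice to link them. The table can be chosen
  nonconstructively, as only its finitely many entries for instances of bounded size go into the
  machine, and consulting it takes a constant number of steps.\<close>

definition runs :: "'a tm \<Rightarrow> (nat \<Rightarrow> 'a tape) \<Rightarrow> (nat \<Rightarrow> 'a tape) \<Rightarrow> nat \<Rightarrow> bool" where
  "runs M T T' t \<longleftrightarrow> halted M ((step M ^^ t) (0, T)) \<and> snd ((step M ^^ t) (0, T)) = T'"

lemma computes_within_iff_runs:
  "computes_within M xss yss t \<longleftrightarrow>
     (\<exists>T'. runs M (snd (init xss)) T' t \<and> (\<forall>j < length yss. T' (length xss + j) = tape_of (yss ! j)))"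
proof -
  have "init xss = (0, snd (init xss))"
    by (simp add: init_def)
  then show ?thesis
    unfolding computes_within_def runs_def by metis
qed

lemma step_halted: "halted M c \<Longrightarrow> step M c = c"
  by (simp add: halted_def step_def)

lemma steps_halted: "halted M c \<Longrightarrow> (step M ^^ t) c = c"
  by (induction t) (auto simp: step_halted)

text \<open>Halted configurations are fixed points, so the time in \<open>runs\<close> is only an
  upper bound and estimates may be rounded up.\<close>

lemma runs_mono:
  assumes "runs M T T' t" "t \<le> t'"
  shows "runs M T T' t'"
proof -
  have "(step M ^^ t') (0, T) = (step M ^^ (t' - t)) ((step M ^^ t) (0, T))"
    using assms(2) by (metis comp_apply funpow_add le_add_diff_inverse2)
  then show ?thesis
    using assms(1) by (simp add: runs_def steps_halted)
qed

section \<open>Machines with a fixed number of tapes as programs\<close>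

context
  fixes n a :: nat
begin

text \<open>Independent of the machine: all programs with \<open>n\<close> tapes scan the same
  symbols, so the tests in composed machines can refer to \<open>heads\<close> alone.\<close>

definition heads :: "(nat \<Rightarrow> 'a tape) \<Rightarrow> nat \<Rightarrow> 'a sym" where
  "heads T = (\<lambda>i. if i < n then scan (T i) else Blank)"

text \<open>
  In contrast to \<open>is_tm\<close>, the transitions are constrained for all states and symbols, so that the
  executions of composed machines can be analysed without an invariant.
\<close>

definition program :: "'a tm \<Rightarrow> bool" where
  "program M \<longleftrightarrow> ntapes M = n \<and> naux M = a \<and> 0 < nstates M \<and>
     (\<forall>q r q' act. trans M q r = Some (q', act) \<longrightarrow>
        q' < nstates M \<and> (\<forall>i. fst (act i) \<in> alphabet M \<union> range r))"

lemma program_is_tm: "program M \<Longrightarrow> is_tm M"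
  unfolding program_def is_tm_def by blast

lemma program_ntapes: "program M \<Longrightarrow> ntapes M = n"
  by (simp add: program_def)

lemma program_scanned: "program M \<Longrightarrow> scanned M T = heads T"
  by (simp add: program_def scanned_def heads_def)

definition skip_tm :: "'a tm" where
  "skip_tm = \<lparr>ntapes = n, nstates = 1, naux = a, trans = \<lambda>q r. None\<rparr>"

lemma program_skip [intro]: "program skip_tm"
  by (simp add: program_def skip_tm_def)

lemma runs_skip: "runs skip_tm T T 0"
  by (simp add: runs_def halted_def skip_tm_def)

definition act_tm :: "((nat \<Rightarrow> 'a sym) \<Rightarrow> nat \<Rightarrow> 'a sym \<times> dir) \<Rightarrow> 'a tm" where
  "act_tm f = \<lparr>ntapes = n, nstates = 2, naux = a,
     trans = \<lambda>q r. if q = 0 then Some (1, f r) else None\<rparr>"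

lemma program_act:
  assumes "\<And>r i. fst (f r i) \<in> {Blank, Tick} \<union> range Letter \<union> range r"
  shows "program (act_tm f)"
  unfolding program_def act_tm_def alphabet_def using assms by (auto split: if_splits)

lemma update_tape_scan: "update_tape (scan t, Stay) t = t"
  by (simp add: update_tape_def scan_def)

lemma runs_act:
  assumes "\<And>i. T' i = (if i < n then update_tape (f (heads T) i) (T i) else T i)"
  shows "runs (act_tm f) T T' 1"
proof -
  have "T' = (\<lambda>i. if i < n then update_tape (f (heads T) i) (T i) else T i)"
    using assms by blast
  then show ?thesis
    by (simp add: runs_def halted_def step_def act_tm_def scanned_def heads_def cong: if_cong)
qed

text \<open>
  A flow graph of machines: when the machine at node \<open>j\<close> halts while scanning \<open>r\<close>, control passes
  to the node \<open>nxt j r\<close>. State \<open>q\<close> at node \<open>j\<close> is encoded as \<open>q * length Ms + j\<close>.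
\<close>

definition flow_tm :: "'a tm list \<Rightarrow> (nat \<Rightarrow> (nat \<Rightarrow> 'a sym) \<Rightarrow> nat option) \<Rightarrow> 'a tm" where
  "flow_tm Ms nxt = \<lparr>ntapes = n, nstates = length Ms * sum_list (map nstates Ms), naux = a,
     trans = \<lambda>s r. let j = s mod length Ms in
       case trans (Ms ! j) (s div length Ms) r of
         Some (q', act) \<Rightarrow> Some (q' * length Ms + j, act)
       | None \<Rightarrow> map_option (\<lambda>j'. (j', \<lambda>i. (r i, Stay))) (nxt j r)\<rparr>"

text \<open>The sum of all state counts serves as a common bound for every node, which keeps all
  codes \<open>q * length Ms + j\<close> below \<open>nstates\<close>.\<close>

lemma program_flow:
  assumes prog: "\<And>M. M \<in> set Ms \<Longrightarrow> program M" and ne: "Ms \<noteq> []"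
    and nxt: "\<And>j r j'. j < length Ms \<Longrightarrow> nxt j r = Some j' \<Longrightarrow> j' < length Ms"
  shows "program (flow_tm Ms nxt)"
proof -
  let ?k = "length Ms" and ?N = "sum_list (map nstates Ms)"
  have k: "0 < ?k" using ne by simp
  have le: "nstates (Ms ! j) \<le> ?N" if "j < ?k" for j
    using that by (intro member_le_sum_list) auto
  have "0 < nstates (Ms ! 0)"
    using prog[of "Ms ! 0"] k by (simp add: program_def)
  then have N: "0 < ?N" using le[OF k] by linarith
  have "q' < ?k * ?N \<and> (\<forall>i. fst (act i) \<in> alphabet (flow_tm Ms nxt) \<union> range r)"
    if tr: "trans (flow_tm Ms nxt) s r = Some (q', act)" for s r q' act
  proof -
    define j where "j = s mod ?k"
    have j: "j < ?k" using k by (simp add: j_def)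
    have Pj: "program (Ms ! j)" using prog j by simp
    have al: "alphabet (Ms ! j) = alphabet (flow_tm Ms nxt)"
      using Pj by (simp add: program_def alphabet_def flow_tm_def)
    show ?thesis
    proof (cases "trans (Ms ! j) (s div ?k) r")
      case None
      then obtain j' where j': "nxt j r = Some j'" "q' = j'" "act = (\<lambda>i. (r i, Stay))"
        using tr by (auto simp: flow_tm_def j_def Let_def)
      have "j' < ?k * 1" using nxt[OF j j'(1)] by simp
      also have "\<dots> \<le> ?k * ?N" using N by (intro mult_le_mono) auto
      finally show ?thesis using j' by simp
    next
      case (Some x)
      then obtain q1 where q1: "trans (Ms ! j) (s div ?k) r = Some (q1, act)" "q' = q1 * ?k + j"
        using tr by (cases x) (auto simp: flow_tm_def j_def Let_def)
      have lt: "q1 < nstates (Ms ! j)" and actok: "\<forall>i. fst (act i) \<in> alphabet (Ms ! j) \<union> range r"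
        using Pj q1(1) unfolding program_def by blast+
      have "q' < (q1 + 1) * ?k" using q1(2) j by simp
      also have "\<dots> \<le> ?N * ?k" using lt le[OF j] by (intro mult_le_mono) auto
      finally show ?thesis using actok al by (simp add: mult.commute)
    qed
  qed
  then show ?thesis
    unfolding program_def using k N by (auto simp: flow_tm_def)
qed

text \<open>The time \<open>t\<close> may exceed the halting time of the node. The node then idles,
  whereas the flow machine may already leave it; the simulation therefore ends at the first halting
  configuration, after \<open>t0\<close> steps.\<close>

lemma flow_simulates:
  assumes j: "j < length Ms" and prog: "program (Ms ! j)"
    and halt: "halted (Ms ! j) ((step (Ms ! j) ^^ t) (q, T))"
    and fin: "(step (Ms ! j) ^^ t) (q, T) = (q', T')"
  shows "\<exists>t0 \<le> t. (step (flow_tm Ms nxt) ^^ t0) (q * length Ms + j, T) = (q' * length Ms + j, T')"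
  using halt fin
proof (induction t arbitrary: q T)
  case 0
  then show ?case by simp
next
  case (Suc t)
  show ?case
  proof (cases "halted (Ms ! j) (q, T)")
    case True
    then show ?thesis
      using Suc.prems(2) steps_halted[OF True, of "Suc t"] by (intro exI[of _ 0]) simp
  next
    case False
    obtain q1 T1 where st: "step (Ms ! j) (q, T) = (q1, T1)" by fastforce
    have "(q * length Ms + j) div length Ms = q" using j by (subst div_mult_self3) auto
    then have "step (flow_tm Ms nxt) (q * length Ms + j, T) = (q1 * length Ms + j, T1)"
      using False st j program_ntapes[OF prog]
      by (auto simp: halted_def step_def flow_tm_def scanned_def Let_def cong: if_cong
          split: option.splits)
    moreover obtain t0 where "t0 \<le> t"
      "(step (flow_tm Ms nxt) ^^ t0) (q1 * length Ms + j, T1) = (q' * length Ms + j, T')"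
      using Suc.IH[of q1 T1] Suc.prems st by (auto simp: funpow_Suc_right simp del: funpow.simps)
    ultimately show ?thesis
      by (intro exI[of _ "Suc t0"]) (simp add: funpow_Suc_right del: funpow.simps)
  qed
qed

text \<open>The start state \<open>j\<close> is the code of state 0 at node
  \<open>j\<close>.\<close>

definition flow_runs where
  "flow_runs Ms nxt j T T' t \<longleftrightarrow>
     (\<exists>q. (step (flow_tm Ms nxt) ^^ t) (j, T) = (q, T') \<and> halted (flow_tm Ms nxt) (q, T'))"

lemma runs_flow: "flow_runs Ms nxt 0 T T' t \<Longrightarrow> runs (flow_tm Ms nxt) T T' t"
  by (auto simp: flow_runs_def runs_def)

lemma flow_node:
  assumes j: "j < length Ms" and prog: "program (Ms ! j)" and run: "runs (Ms ! j) T T' t"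
  obtains q t0 where "t0 \<le> t" "(step (flow_tm Ms nxt) ^^ t0) (j, T) = (q * length Ms + j, T')"
    "trans (Ms ! j) q (heads T') = None"
proof -
  obtain q where q: "(step (Ms ! j) ^^ t) (0, T) = (q, T')"
    using run by (metis runs_def prod.collapse)
  then have "halted (Ms ! j) (q, T')" using run by (simp add: runs_def)
  then have "trans (Ms ! j) q (heads T') = None"
    using prog by (simp add: halted_def program_scanned)
  moreover obtain t0 where "t0 \<le> t" "(step (flow_tm Ms nxt) ^^ t0) (j, T) = (q * length Ms + j, T')"
    using flow_simulates[OF j prog _ q] run by (fastforce simp: runs_def)
  ultimately show thesis using that by blast
qed

lemma flow_exit:
  assumes j: "j < length Ms" and prog: "program (Ms ! j)" and run: "runs (Ms ! j) T T' t"
    and nxt: "nxt j (heads T') = None"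
  shows "flow_runs Ms nxt j T T' t"
proof -
  obtain q t0 where q: "t0 \<le> t" "(step (flow_tm Ms nxt) ^^ t0) (j, T) = (q * length Ms + j, T')"
    "trans (Ms ! j) q (heads T') = None"
    using flow_node[OF j prog run] by blast
  have "(q * length Ms + j) div length Ms = q" using j by (subst div_mult_self3) auto
  then have h: "halted (flow_tm Ms nxt) (q * length Ms + j, T')"
    using q(3) nxt j by (simp add: halted_def heads_def scanned_def flow_tm_def cong: if_cong)
  have "(step (flow_tm Ms nxt) ^^ t) (j, T) = (step (flow_tm Ms nxt) ^^ (t - t0)) ((step (flow_tm Ms nxt) ^^ t0) (j, T))"
    using q(1) by (metis comp_apply funpow_add le_add_diff_inverse2)
  then show ?thesis
    unfolding flow_runs_def using q(2) h by (auto simp: steps_halted)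
qed

text \<open>The extra step is the transfer of control, which rewrites the scanned symbols and so
  leaves all tapes unchanged.\<close>

lemma flow_next:
  assumes j: "j < length Ms" and prog: "program (Ms ! j)" and run: "runs (Ms ! j) T T' t"
    and nxt: "nxt j (heads T') = Some j'" and rest: "flow_runs Ms nxt j' T' T'' t'"
  shows "flow_runs Ms nxt j T T'' (t + t' + 1)"
proof -
  let ?F = "flow_tm Ms nxt"
  obtain q t0 where q: "t0 \<le> t" "(step ?F ^^ t0) (j, T) = (q * length Ms + j, T')"
    "trans (Ms ! j) q (heads T') = None"
    using flow_node[OF j prog run] by blast
  have "(q * length Ms + j) div length Ms = q" using j by (subst div_mult_self3) auto
  then have s: "step ?F (q * length Ms + j, T') = (j', T')"
    using q(3) nxt j
    unfolding step_def heads_def scanned_def flow_tm_def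
    by (auto simp: update_tape_scan fun_eq_iff cong: if_cong)
  obtain q' where q': "(step ?F ^^ t') (j', T') = (q', T'')" "halted ?F (q', T'')"
    using rest by (auto simp: flow_runs_def)
  \<comment> \<open>The \<open>t - t0\<close> steps that the node did not need are moved to the end,
    where the halted machine absorbs them.\<close>
  have "t + t' + 1 = (t - t0) + (t' + (1 + t0))" using q(1) by simp
  then have "(step ?F ^^ (t + t' + 1)) (j, T) =
      (step ?F ^^ (t - t0)) ((step ?F ^^ t') (step ?F ((step ?F ^^ t0) (j, T))))"
    by (simp only: funpow_add comp_apply) simp
  also have "\<dots> = (q', T'')"
    using q(2) s q' by (simp add: steps_halted)
  finally show ?thesis unfolding flow_runs_def using q' by blast
qed

section \<open>Sequencing, branching and loops as flow graphs\<close>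

definition seq_tm :: "'a tm \<Rightarrow> 'a tm \<Rightarrow> 'a tm" where
  "seq_tm M1 M2 = flow_tm [M1, M2] (\<lambda>j r. if j = 0 then Some 1 else None)"

text \<open>\<open>skip_tm\<close> halts at once, so node 0 does nothing but evaluate the test in
  its exit function.\<close>

definition if_tm :: "((nat \<Rightarrow> 'a sym) \<Rightarrow> bool) \<Rightarrow> 'a tm \<Rightarrow> 'a tm \<Rightarrow> 'a tm" where
  "if_tm P M1 M2 = flow_tm [skip_tm, M1, M2]
     (\<lambda>j r. if j = 0 then Some (if P r then 1 else 2) else None)"

definition while_tm :: "((nat \<Rightarrow> 'a sym) \<Rightarrow> bool) \<Rightarrow> 'a tm \<Rightarrow> 'a tm" where
  "while_tm P M = flow_tm [skip_tm, M]
     (\<lambda>j r. if j = 0 then (if P r then Some 1 else None) else Some 0)"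

lemma program_seq [intro]: "program M1 \<Longrightarrow> program M2 \<Longrightarrow> program (seq_tm M1 M2)"
  unfolding seq_tm_def by (rule program_flow) (auto split: if_splits)

lemma program_if [intro]: "program M1 \<Longrightarrow> program M2 \<Longrightarrow> program (if_tm P M1 M2)"
  unfolding if_tm_def by (rule program_flow) (auto split: if_splits)

lemma program_while [intro]: "program M \<Longrightarrow> program (while_tm P M)"
  unfolding while_tm_def by (rule program_flow) (auto split: if_splits)

lemma runs_seq:
  assumes "program M1" "program M2" "runs M1 T T' t1" "runs M2 T' T'' t2"
  shows "runs (seq_tm M1 M2) T T'' (t1 + t2 + 1)"
proof -
  let ?nxt = "\<lambda>j r. if j = 0 then Some 1 else None"
  have "flow_runs [M1, M2] ?nxt 1 T' T'' t2"
    using assms by (intro flow_exit) auto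
  then have "flow_runs [M1, M2] ?nxt 0 T T'' (t1 + t2 + 1)"
    using assms by (intro flow_next[where j = 0 and j' = 1]) auto
  then show ?thesis unfolding seq_tm_def by (rule runs_flow)
qed

lemma runs_if_true:
  assumes "program M1" "program M2" "P (heads T)" "runs M1 T T' t"
  shows "runs (if_tm P M1 M2) T T' (t + 1)"
proof -
  let ?nxt = "\<lambda>j r. if j = 0 then Some (if P r then 1 else 2) else None"
  have "flow_runs [skip_tm, M1, M2] ?nxt 1 T T' t"
    using assms by (intro flow_exit) auto
  then have "flow_runs [skip_tm, M1, M2] ?nxt 0 T T' (0 + t + 1)"
    using assms by (intro flow_next[where j = 0 and j' = 1]) (auto intro: runs_skip)
  then show ?thesis unfolding if_tm_def by (intro runs_flow) simp
qed

lemma runs_if_false: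
  assumes "program M1" "program M2" "\<not> P (heads T)" "runs M2 T T' t"
  shows "runs (if_tm P M1 M2) T T' (t + 1)"
proof -
  let ?nxt = "\<lambda>j r. if j = 0 then Some (if P r then 1 else 2) else None"
  have "flow_runs [skip_tm, M1, M2] ?nxt 2 T T' t"
    using assms by (intro flow_exit) auto
  then have "flow_runs [skip_tm, M1, M2] ?nxt 0 T T' (0 + t + 1)"
    using assms by (intro flow_next[where j = 0 and j' = 2]) (auto intro: runs_skip)
  then show ?thesis unfolding if_tm_def by (intro runs_flow) simp
qed

lemma runs_while_false:
  assumes "\<not> P (heads T)"
  shows "runs (while_tm P M) T T 0"
  unfolding while_tm_def using assms
  by (intro runs_flow flow_exit) (auto intro: runs_skip)

text \<open>Each round costs two transfers of control: from the test to the body and back.\<close>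

lemma runs_while_true:
  assumes "program M" "P (heads T)" "runs M T T' t" "runs (while_tm P M) T' T'' t'"
  shows "runs (while_tm P M) T T'' (t + t' + 2)"
proof -
  let ?nxt = "\<lambda>j r. if j = 0 then (if P r then Some 1 else None) else Some (0::nat)"
  have "flow_runs [skip_tm, M] ?nxt 0 T' T'' t'"
    using assms(4) unfolding while_tm_def runs_def flow_runs_def by (metis prod.collapse)
  then have "flow_runs [skip_tm, M] ?nxt 1 T T'' (t + t' + 1)"
    using assms by (intro flow_next[where j = 1 and j' = 0]) auto
  then have "flow_runs [skip_tm, M] ?nxt 0 T T'' (0 + (t + t' + 1) + 1)"
    using assms by (intro flow_next[where j = 0 and j' = 1]) (auto intro: runs_skip)
  then show ?thesis unfolding while_tm_def by (intro runs_flow) simp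
qed

section \<open>Basic programs\<close>

definition move_tm :: "nat \<Rightarrow> dir \<Rightarrow> 'a tm" where
  "move_tm i d = act_tm (\<lambda>r. (\<lambda>k. (r k, Stay))(i := (r i, d)))"

definition put_tm :: "nat \<Rightarrow> 'a sym \<Rightarrow> 'a tm" where
  "put_tm i x = act_tm (\<lambda>r. (\<lambda>k. (r k, Stay))(i := (x, GoRight)))"

definition copy_cell_tm :: "nat \<Rightarrow> nat \<Rightarrow> 'a tm" where
  "copy_cell_tm i j = act_tm (\<lambda>r. (\<lambda>k. (r k, Stay))(i := (r i, GoRight), j := (r i, GoRight)))"

lemma program_move [intro]: "program (move_tm i d)"
  unfolding move_tm_def by (rule program_act) auto

lemma program_put [intro]: "x \<in> {Blank, Tick} \<union> range Letter \<Longrightarrow> program (put_tm i x)"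
  unfolding put_tm_def by (rule program_act) auto

lemma program_copy_cell [intro]: "program (copy_cell_tm i j)"
  unfolding copy_cell_tm_def by (rule program_act) auto

lemma runs_move:
  assumes "i < n"
  shows "runs (move_tm i d) T (T(i := (fst (T i) + shift d, snd (T i)))) 1"
  unfolding move_tm_def using assms
  by (intro runs_act) (auto simp: heads_def update_tape_scan, auto simp: update_tape_def scan_def)

lemma runs_put:
  assumes "i < n"
  shows "runs (put_tm i x) T (T(i := (fst (T i) + 1, (snd (T i))(fst (T i) := x)))) 1"
  unfolding put_tm_def using assms
  by (intro runs_act) (auto simp: heads_def update_tape_scan, auto simp: update_tape_def scan_def)

lemma runs_copy_cell:
  assumes "i < n" "j < n" "i \<noteq> j"
  shows "runs (copy_cell_tm i j) T
    (T(i := (fst (T i) + 1, snd (T i)), j := (fst (T j) + 1, (snd (T j))(fst (T j) := scan (T i))))) 1"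
  unfolding copy_cell_tm_def using assms
  by (intro runs_act) (auto simp: heads_def update_tape_scan, auto simp: update_tape_def scan_def)

section \<open>Strings on tapes: rewinding, copying and writing\<close>

definition tape_at :: "int \<Rightarrow> 'a sym list \<Rightarrow> 'a tape" where
  "tape_at m xs = (m, snd (tape_of xs))"

lemma tape_at_0: "tape_at 0 xs = tape_of xs"
  by (simp add: tape_at_def tape_of_def)

lemma fst_tape_at [simp]: "fst (tape_at m xs) = m"
  by (simp add: tape_at_def)

lemma move_tape_at: "(m', snd (tape_at m xs)) = tape_at m' xs"
  by (simp add: tape_at_def)

lemma scan_tape_at:
  "scan (tape_at m xs) = (if 0 \<le> m \<and> m < int (length xs) then xs ! nat m else Blank)"
  by (simp add: scan_def tape_at_def tape_of_def)

lemma append_tape_at: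
  "(m, (snd (tape_at m' xs))(int (length xs) := x)) = tape_at m (xs @ [x])"
  by (auto simp: tape_at_def tape_of_def fun_eq_iff nth_append nat_eq_iff)

text \<open>Strings must be handed over with the head on the first cell. Starting on the blank
  behind the string, the head runs left to the blank at position -1 and comes back by one cell; a
  blank inside the string would stop it early.\<close>

definition rewind_tm :: "nat \<Rightarrow> 'a tm" where
  "rewind_tm i = seq_tm (move_tm i GoLeft)
     (seq_tm (while_tm (\<lambda>r. r i \<noteq> Blank) (move_tm i GoLeft)) (move_tm i GoRight))"

lemma program_rewind [intro]: "program (rewind_tm i)"
  unfolding rewind_tm_def by auto

lemma runs_rewind:
  assumes i: "i < n" and T: "T i = tape_at (int (length xs)) xs" and xs: "Blank \<notin> set xs"
  shows "runs (rewind_tm i) T (T(i := tape_of xs)) (3 * length xs + 4)"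
proof -
  let ?W = "while_tm (\<lambda>r. r i \<noteq> Blank) (move_tm i GoLeft)"
  \<comment> \<open>\<open>m\<close> counts the cells still to be passed; for \<open>m = 0\<close>
    the head is on the blank to the left of the string. One step and two transfers of control per
    cell give the factor 3.\<close>
  have loop: "runs ?W (T(i := tape_at (int m - 1) xs)) (T(i := tape_at (-1) xs)) (3 * m)"
    if "m \<le> length xs" for m
    using that
  proof (induction m)
    case 0
    have "runs ?W (T(i := tape_at (-1) xs)) (T(i := tape_at (-1) xs)) 0"
      by (rule runs_while_false) (simp add: heads_def scan_tape_at)
    then show ?case by (simp del: fun_upd_apply)
  next
    case (Suc m)
    let ?T = "T(i := tape_at (int m) xs)"
    have "xs ! m \<noteq> Blank" using Suc.prems xs by (metis Suc_le_lessD nth_mem)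
    then have 1: "heads ?T i \<noteq> Blank" using i Suc.prems by (simp add: heads_def scan_tape_at)
    have 2: "runs (move_tm i GoLeft) ?T (T(i := tape_at (int m - 1) xs)) 1"
      using runs_move[OF i, of GoLeft ?T] by (simp add: move_tape_at)
    have "runs ?W ?T (T(i := tape_at (-1) xs)) (1 + 3 * m + 2)"
      using Suc 1 2 by (intro runs_while_true) (auto simp del: fun_upd_apply)
    then have "runs ?W ?T (T(i := tape_at (-1) xs)) (3 * Suc m)" by (rule runs_mono) simp
    then show ?case by (simp del: fun_upd_apply)
  qed
  have "runs (move_tm i GoLeft) T (T(i := tape_at (int (length xs) - 1) xs)) 1"
    using runs_move[OF i, of GoLeft T] by (simp add: T move_tape_at)
  moreover have "runs (move_tm i GoRight) (T(i := tape_at (-1) xs)) (T(i := tape_of xs)) 1"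
    using runs_move[OF i, of GoRight "T(i := tape_at (-1) xs)"] by (simp add: move_tape_at tape_at_0)
  ultimately have "runs (rewind_tm i) T (T(i := tape_of xs)) (1 + (3 * length xs + 1 + 1) + 1)"
    unfolding rewind_tm_def using loop[of "length xs"] by (intro runs_seq) auto
  then show ?thesis by (rule runs_mono) simp
qed

definition copy_tm :: "nat \<Rightarrow> nat \<Rightarrow> 'a tm" where
  "copy_tm i j = seq_tm (while_tm (\<lambda>r. r i \<noteq> Blank) (copy_cell_tm i j))
     (seq_tm (rewind_tm i) (rewind_tm j))"

lemma program_copy [intro]: "program (copy_tm i j)"
  unfolding copy_tm_def by auto

lemma runs_copy:
  assumes ij: "i < n" "j < n" "i \<noteq> j" and Ti: "T i = tape_of xs" and Tj: "T j = tape_of []"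
    and xs: "Blank \<notin> set xs"
  shows "runs (copy_tm i j) T (T(j := tape_of xs)) (9 * length xs + 10)"
proof -
  let ?W = "while_tm (\<lambda>r. r i \<noteq> Blank) (copy_cell_tm i j)"
  let ?end = "T(i := tape_at (int (length xs)) xs, j := tape_at (int (length xs)) xs)"
  \<comment> \<open>Invariant: \<open>ys\<close> has been copied already and \<open>zs\<close>
    remains.\<close>
  have loop: "runs ?W (T(i := tape_at (int (length ys)) xs, j := tape_at (int (length ys)) ys)) ?end
      (3 * length zs)" if "xs = ys @ zs" for ys zs
    using that
  proof (induction zs arbitrary: ys)
    case Nil
    then have "runs ?W ?end ?end 0"
      using ij by (intro runs_while_false) (simp add: heads_def scan_tape_at)
    then show ?case using Nil by (simp del: fun_upd_apply)
  next
    case (Cons z zs)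
    let ?T = "T(i := tape_at (int (length ys)) xs, j := tape_at (int (length ys)) ys)"
    let ?ys = "ys @ [z]"
    let ?T' = "T(i := tape_at (int (length ?ys)) xs, j := tape_at (int (length ?ys)) ?ys)"
    have sc: "scan (?T i) = z" using ij Cons.prems by (simp add: scan_tape_at nth_append)
    have 1: "heads ?T i \<noteq> Blank" using sc ij Cons.prems xs by (auto simp: heads_def)
    have 2: "runs (copy_cell_tm i j) ?T ?T' 1"
      using runs_copy_cell[OF ij, of ?T] ij sc
      by (simp add: move_tape_at append_tape_at fun_upd_twist add.commute)
    have "runs ?W ?T ?end (1 + 3 * length zs + 2)"
      using 1 2 Cons.IH[of ?ys] Cons.prems by (intro runs_while_true) (auto simp del: fun_upd_apply)
    then show ?case by (rule runs_mono) simp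
  qed
  have "T = T(i := tape_at 0 xs, j := tape_at 0 [])"
    by (simp add: tape_at_0 flip: Ti Tj)
  then have 1: "runs ?W T ?end (3 * length xs)"
    using loop[of "[]" xs] by simp
  have 2: "runs (rewind_tm i) ?end (?end(i := tape_of xs)) (3 * length xs + 4)"
    using ij xs by (intro runs_rewind) auto
  have 3: "runs (rewind_tm j) (?end(i := tape_of xs)) (?end(i := tape_of xs, j := tape_of xs)) (3 * length xs + 4)"
    using ij xs by (intro runs_rewind) auto
  have fin: "?end(i := tape_of xs, j := tape_of xs) = T(j := tape_of xs)"
    using Ti by (auto simp: fun_eq_iff)
  have "runs (copy_tm i j) T (T(j := tape_of xs)) (3 * length xs + (3 * length xs + 4 + (3 * length xs + 4) + 1) + 1)"
    unfolding copy_tm_def using 1 2 3[unfolded fin] by (intro runs_seq) auto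
  then show ?thesis by (rule runs_mono) simp
qed

primrec write_tm :: "nat \<Rightarrow> 'a sym list \<Rightarrow> 'a tm" where
  "write_tm i [] = skip_tm"
| "write_tm i (x # w) = seq_tm (put_tm i x) (write_tm i w)"

lemma program_write [intro]:
  "set w \<subseteq> {Blank, Tick} \<union> range Letter \<Longrightarrow> program (write_tm i w)"
  by (induction w) auto

lemma runs_write:
  assumes "i < n" "set w \<subseteq> {Blank, Tick} \<union> range Letter" "T i = tape_at (int (length ys)) ys"
  shows "runs (write_tm i w) T (T(i := tape_at (int (length (ys @ w))) (ys @ w))) (2 * length w)"
  using assms
proof (induction w arbitrary: T ys)
  case Nil
  have "T(i := tape_at (int (length ys)) ys) = T" using Nil by (intro fun_upd_idem) simp
  then show ?case using runs_skip[of T] by (simp del: fun_upd_apply)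
next
  case (Cons x w)
  let ?ys = "ys @ [x]"
  let ?T' = "T(i := tape_at (int (length ?ys)) ?ys)"
  have 1: "runs (put_tm i x) T ?T' 1"
    using runs_put[OF Cons.prems(1), of x T] Cons.prems(3) by (simp add: append_tape_at add.commute)
  have 2: "runs (write_tm i w) ?T' (?T'(i := tape_at (int (length (?ys @ w))) (?ys @ w))) (2 * length w)"
    using Cons.prems by (intro Cons.IH) auto
  have "runs (write_tm i (x # w)) T (?T'(i := tape_at (int (length (?ys @ w))) (?ys @ w))) (1 + 2 * length w + 1)"
    unfolding write_tm.simps using 1 2 Cons.prems by (intro runs_seq) auto
  then show ?case by (simp del: fun_upd_apply)
qed

section \<open>Case distinction on symbols and on strings of bounded length\<close>

primrec branch_tm :: "nat \<Rightarrow> 'a sym list \<Rightarrow> ('a sym \<Rightarrow> 'a tm) \<Rightarrow> 'a tm \<Rightarrow> 'a tm" where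
  "branch_tm i [] F D = D"
| "branch_tm i (x # xs) F D = if_tm (\<lambda>r. r i = x) (F x) (branch_tm i xs F D)"

lemma program_branch [intro]:
  "(\<And>x. x \<in> set xs \<Longrightarrow> program (F x)) \<Longrightarrow> program D \<Longrightarrow> program (branch_tm i xs F D)"
  by (induction xs) auto

text \<open>Each test costs one transfer of control; a symbol outside \<open>xs\<close>, such as a
  blank, falls through to \<open>D\<close>.\<close>

lemma runs_branch:
  assumes "\<And>x. x \<in> set xs \<Longrightarrow> program (F x)" "program D"
    and "runs (if heads T i \<in> set xs then F (heads T i) else D) T T' t"
  shows "runs (branch_tm i xs F D) T T' (t + length xs)"
  using assms
proof (induction xs)
  case Nil
  then show ?case by simp
next
  case (Cons x xs)
  show ?case
  proof (cases "heads T i = x")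
    case True
    have "runs (branch_tm i (x # xs) F D) T T' (t + 1)"
      unfolding branch_tm.simps using Cons.prems True by (intro runs_if_true) auto
    then show ?thesis by (rule runs_mono) simp
  next
    case False
    have "runs (branch_tm i (x # xs) F D) T T' (t + length xs + 1)"
      unfolding branch_tm.simps using Cons False by (intro runs_if_false) auto
    then show ?thesis by simp
  qed
qed

text \<open>The string read is remembered in the finite control: it selects the machine \<open>F w\<close> to continue with.\<close>

primrec read_tm :: "nat \<Rightarrow> 'a sym list \<Rightarrow> nat \<Rightarrow> ('a sym list \<Rightarrow> 'a tm) \<Rightarrow> 'a tm" where
  "read_tm i xs 0 F = F []"
| "read_tm i xs (Suc c) F = branch_tm i xs
     (\<lambda>x. seq_tm (move_tm i GoRight) (read_tm i xs c (\<lambda>w. F (x # w)))) (F [])"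

lemma program_read [intro]:
  "(\<And>w. program (F w)) \<Longrightarrow> program (read_tm i xs c F)"
  by (induction c arbitrary: F) (simp_all add: program_branch program_seq program_move)

text \<open>\<open>ys\<close> has been read already and \<open>w\<close> remains. The machine has to
  be finite, so the recursion is unrolled only \<open>c\<close> times, and after \<open>c\<close>
  symbols no blank is looked for; hence \<open>length w \<le> c\<close>. The end of a shorter string
  shows as a blank, which is not in \<open>xs\<close> and selects the default branch.\<close>

lemma runs_read:
  assumes "i < n" "\<And>w. program (F w)" "Blank \<notin> set xs" "set w \<subseteq> set xs" "length w \<le> c"
    and "T i = tape_at (int (length ys)) (ys @ w)"
    and "runs (F w) (T(i := tape_at (int (length (ys @ w))) (ys @ w))) T' t"
  shows "runs (read_tm i xs c F) T T' (t + (length xs + 2) * c)"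
  using assms
proof (induction c arbitrary: F T ys w)
  case 0
  have "T(i := tape_at (int (length ys)) ys) = T" using 0 by (intro fun_upd_idem) simp
  then show ?case using 0 by (simp del: fun_upd_apply)
next
  case (Suc c)
  have prg: "program (seq_tm (move_tm i GoRight) (read_tm i xs c (\<lambda>w. F (x # w))))" for x
    using Suc.prems(2) by auto
  show ?case
  proof (cases w)
    case Nil
    have "T(i := tape_at (int (length ys)) ys) = T" using Suc.prems(6) Nil by (intro fun_upd_idem) simp
    then have r: "runs (F []) T T' t" using Suc.prems(7) Nil by (simp del: fun_upd_apply)
    have "heads T i = Blank" using Suc.prems(1,6) Nil by (simp add: heads_def scan_tape_at)
    then have "runs (read_tm i xs (Suc c) F) T T' (t + length xs)"
      unfolding read_tm.simps using Suc.prems(2,3) r prg by (intro runs_branch) auto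
    then show ?thesis by (rule runs_mono) simp
  next
    case (Cons x v)
    let ?ys = "ys @ [x]"
    let ?T = "T(i := tape_at (int (length ?ys)) (?ys @ v))"
    have h: "heads T i = x" using Suc.prems(1,6) Cons by (simp add: heads_def scan_tape_at nth_append)
    have 1: "runs (move_tm i GoRight) T ?T 1"
      using runs_move[OF Suc.prems(1), of GoRight T] Suc.prems(6) Cons
      by (simp add: move_tape_at add.commute)
    have 2: "runs (read_tm i xs c (\<lambda>w. F (x # w))) ?T T' (t + (length xs + 2) * c)"
      using Suc.prems Cons by (intro Suc.IH[of "\<lambda>w. F (x # w)" v ?T ?ys]) (auto simp del: fun_upd_apply simp: fun_upd_same)
    have "runs (seq_tm (move_tm i GoRight) (read_tm i xs c (\<lambda>w. F (x # w)))) T T'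
        (1 + (t + (length xs + 2) * c) + 1)"
      using 1 2 Suc.prems(2) by (intro runs_seq) auto
    then have "runs (read_tm i xs (Suc c) F) T T' (1 + (t + (length xs + 2) * c) + 1 + length xs)"
      unfolding read_tm.simps using Suc.prems(2,4) prg h Cons by (intro runs_branch) auto
    then show ?thesis by (rule runs_mono) (simp add: algebra_simps)
  qed
qed

section \<open>Running a machine on renamed tapes\<close>

text \<open>\<open>is_tm\<close> leaves transitions on foreign states or symbols unrestricted,
  whereas \<open>program\<close> constrains all of them; the guard turns such transitions into
  halting.\<close>

definition embed_tm :: "(nat \<Rightarrow> nat) \<Rightarrow> 'a tm \<Rightarrow> 'a tm" where
  "embed_tm \<sigma> M = \<lparr>ntapes = n, nstates = nstates M, naux = a,
     trans = \<lambda>q r. let r' = (\<lambda>i. if i < ntapes M then r (\<sigma> i) else Blank) in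
       if q < nstates M \<and> range r' \<subseteq> alphabet M
       then map_option (\<lambda>(q', act). (q', \<lambda>j. if j \<in> \<sigma> ` {..<ntapes M} then act (inv \<sigma> j) else (r j, Stay)))
         (trans M q r')
       else None\<rparr>"

lemma trans_embed:
  assumes "q < nstates M" "range r' \<subseteq> alphabet M"
    and "(\<lambda>i. if i < ntapes M then r (\<sigma> i) else Blank) = r'"
  shows "trans (embed_tm \<sigma> M) q r = map_option
      (\<lambda>(q', act). (q', \<lambda>j. if j \<in> \<sigma> ` {..<ntapes M} then act (inv \<sigma> j) else (r j, Stay)))
      (trans M q r')"
  unfolding embed_tm_def Let_def by (simp only: tm.select_convs assms(3)) (simp add: assms(1,2))

lemma program_embed:
  assumes "is_tm M" "naux M \<le> a" "inj \<sigma>"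
  shows "program (embed_tm \<sigma> M)"
proof -
  have al: "alphabet M \<subseteq> alphabet (embed_tm \<sigma> M)"
    using assms(2) by (auto simp: alphabet_def embed_tm_def)
  have "q' < nstates M \<and> (\<forall>i. fst (act i) \<in> alphabet (embed_tm \<sigma> M) \<union> range r)"
    if tr: "trans (embed_tm \<sigma> M) q r = Some (q', act)" for q r q' act
  proof -
    let ?r = "\<lambda>i. if i < ntapes M then r (\<sigma> i) else Blank"
    obtain act' where *: "q < nstates M" "range ?r \<subseteq> alphabet M" "trans M q ?r = Some (q', act')"
      "act = (\<lambda>j. if j \<in> \<sigma> ` {..<ntapes M} then act' (inv \<sigma> j) else (r j, Stay))"
      using tr by (auto simp: embed_tm_def Let_def split: if_splits)
    have "q' < nstates M \<and> (\<forall>i < ntapes M. fst (act' i) \<in> alphabet M)"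
      using assms(1) *(1-3) unfolding is_tm_def by metis
    then have "q' < nstates M" and ok: "\<And>i. i < ntapes M \<Longrightarrow> fst (act' i) \<in> alphabet M"
      by auto
    moreover have "fst (act j) \<in> alphabet (embed_tm \<sigma> M) \<union> range r" for j
    proof (cases "j \<in> \<sigma> ` {..<ntapes M}")
      case True
      then obtain i where "j = \<sigma> i" "i < ntapes M" by auto
      then show ?thesis using True ok[of i] al assms(3) by (auto simp: *(4))
    next
      case False
      then show ?thesis by (simp add: *(4))
    qed
    ultimately show ?thesis by blast
  qed
  moreover have "ntapes (embed_tm \<sigma> M) = n" "naux (embed_tm \<sigma> M) = a"
    "nstates (embed_tm \<sigma> M) = nstates M"
    by (simp_all add: embed_tm_def)
  moreover have "0 < nstates M" using assms(1) by (simp add: is_tm_def)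
  ultimately show ?thesis
    unfolding program_def by simp
qed

text \<open>The full range of \<open>\<sigma>\<close> is used, not only the images of the tapes of
  the machine: the machine changes nothing beyond its own tapes, and \<open>T\<close> is then simply
  the merge of \<open>T\<close> with \<open>T \<circ> \<sigma>\<close>.\<close>

definition merge :: "(nat \<Rightarrow> nat) \<Rightarrow> (nat \<Rightarrow> 'a tape) \<Rightarrow> (nat \<Rightarrow> 'a tape) \<Rightarrow> nat \<Rightarrow> 'a tape" where
  "merge \<sigma> T U = (\<lambda>j. if j \<in> range \<sigma> then U (inv \<sigma> j) else T j)"

text \<open>The invariant under which the guard of \<open>embed_tm\<close> holds, so that the
  embedded machine behaves like the original.\<close>

definition valid_config :: "'a tm \<Rightarrow> 'a config \<Rightarrow> bool" where
  "valid_config M c \<longleftrightarrow> fst c < nstates M \<and> (\<forall>i < ntapes M. \<forall>z. snd (snd c i) z \<in> alphabet M)"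

lemma merge_image: "inj \<sigma> \<Longrightarrow> merge \<sigma> T U (\<sigma> i) = U i"
  by (simp add: merge_def)

lemma merge_outside: "j \<notin> range \<sigma> \<Longrightarrow> merge \<sigma> T U j = T j"
  by (simp add: merge_def)

lemma valid_scanned: "valid_config M c \<Longrightarrow> range (scanned M (snd c)) \<subseteq> alphabet M"
proof -
  assume *: "valid_config M c"
  have "scanned M (snd c) i \<in> alphabet M" for i
  proof (cases "i < ntapes M")
    case True
    then show ?thesis using * by (auto simp: valid_config_def scanned_def scan_def)
  next
    case False
    then show ?thesis by (simp add: scanned_def alphabet_def)
  qed
  then show ?thesis by blast
qed

lemma valid_step:
  assumes "is_tm M" "valid_config M c"
  shows "valid_config M (step M c)"
proof (cases "trans M (fst c) (scanned M (snd c))")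
  case None
  then show ?thesis using assms by (simp add: step_def)
next
  case (Some x)
  obtain q' act where x: "x = (q', act)" by fastforce
  have "q' < nstates M \<and> (\<forall>i < ntapes M. fst (act i) \<in> alphabet M)"
    using assms Some x valid_scanned[OF assms(2)] unfolding is_tm_def valid_config_def by blast
  then show ?thesis
    using assms(2) Some x by (auto simp: step_def valid_config_def update_tape_def)
qed

lemma embed_step:
  assumes "inj \<sigma>" "\<forall>i < ntapes M. \<sigma> i < n" "valid_config M (q, U)"
  shows "step (embed_tm \<sigma> M) (q, merge \<sigma> T U) =
      (fst (step M (q, U)), merge \<sigma> T (snd (step M (q, U))))"
    and "halted (embed_tm \<sigma> M) (q, merge \<sigma> T U) \<longleftrightarrow> halted M (q, U)"
proof -
  let ?s = "scanned (embed_tm \<sigma> M) (merge \<sigma> T U)"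
  have r: "(\<lambda>i. if i < ntapes M then ?s (\<sigma> i) else Blank) = scanned M U"
    using assms by (auto simp: scanned_def embed_tm_def merge_def fun_eq_iff)
  have ok: "q < nstates M" "range (scanned M U) \<subseteq> alphabet M"
    using assms(3) valid_scanned[OF assms(3)] by (auto simp: valid_config_def)
  note tr = trans_embed[OF ok, where r = ?s and \<sigma> = \<sigma>, OF r]
  show "halted (embed_tm \<sigma> M) (q, merge \<sigma> T U) \<longleftrightarrow> halted M (q, U)"
    using tr by (simp add: halted_def)
  show "step (embed_tm \<sigma> M) (q, merge \<sigma> T U) =
      (fst (step M (q, U)), merge \<sigma> T (snd (step M (q, U))))"
  proof (cases "trans M q (scanned M U)")
    case None
    then show ?thesis using tr by (simp add: step_def)
  next
    case (Some x)
    obtain q' act where x: "x = (q', act)" by fastforce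
    have nt: "ntapes (embed_tm \<sigma> M) = n" by (simp add: embed_tm_def)
    have s: "?s j = scan (merge \<sigma> T U j)" if "j < n" for j
      using that by (simp add: scanned_def nt)
    let ?act = "\<lambda>j. if j \<in> \<sigma> ` {..<ntapes M} then act (inv \<sigma> j) else (?s j, Stay)"
    let ?U = "\<lambda>i. if i < ntapes M then update_tape (act i) (U i) else U i"
    have "(if j < n then update_tape (?act j) (merge \<sigma> T U j) else merge \<sigma> T U j) = merge \<sigma> T ?U j" for j
    proof (cases "j \<in> \<sigma> ` {..<ntapes M}")
      case True
      then obtain i where "j = \<sigma> i" "i < ntapes M" by auto
      then show ?thesis using True assms(1,2) by (simp add: merge_image)
    next
      case False
      then have "merge \<sigma> T ?U j = merge \<sigma> T U j"
        using assms(1) by (auto simp: merge_def)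
      then show ?thesis using False s by (simp add: update_tape_scan)
    qed
    then have "(\<lambda>j. if j < n then update_tape (?act j) (merge \<sigma> T U j) else merge \<sigma> T U j) = merge \<sigma> T ?U"
      by blast
    then show ?thesis
      using tr Some x by (simp add: step_def nt cong: if_cong)
  qed
qed

text \<open>Only the tapes in the range of \<open>\<sigma>\<close> have to look like an initial
  configuration. The other tapes may hold anything, and \<open>merge\<close> keeps it.\<close>

lemma runs_embed:
  assumes "is_tm M" "inj \<sigma>" "\<forall>i < ntapes M. \<sigma> i < n"
    and "T \<circ> \<sigma> = snd (init xss)" "\<forall>xs \<in> set xss. set xs \<subseteq> alphabet M"
    and run: "runs M (snd (init xss)) U t"
  shows "runs (embed_tm \<sigma> M) T (merge \<sigma> T U) t"
proof -
  have T: "T = merge \<sigma> T (T \<circ> \<sigma>)"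
    using assms(2) by (auto simp: merge_def fun_eq_iff)
  have cell: "snd (tape_of xs) z \<in> alphabet M" if "set xs \<subseteq> alphabet M" for xs z
  proof (cases "0 \<le> z \<and> z < int (length xs)")
    case True
    then show ?thesis using that nth_mem[of "nat z" xs] by (auto simp: tape_of_def)
  next
    case False
    then show ?thesis by (auto simp: tape_of_def alphabet_def)
  qed
  have "snd (snd (init xss) i) z \<in> alphabet M" for i z
    using assms(5) by (auto simp: init_def intro!: cell dest: nth_mem)
  then have "valid_config M (0, snd (init xss))"
    using assms(1) by (simp add: valid_config_def is_tm_def)
  then have "let c = (step M ^^ t) (0, snd (init xss)) in valid_config M c \<and>
      (step (embed_tm \<sigma> M) ^^ t) (0, merge \<sigma> T (snd (init xss))) = (fst c, merge \<sigma> T (snd c))"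
  proof (induction t)
    case 0
    then show ?case by simp
  next
    case (Suc t)
    define c where "c = (step M ^^ t) (0, snd (init xss))"
    have "valid_config M c"
      "(step (embed_tm \<sigma> M) ^^ t) (0, merge \<sigma> T (snd (init xss))) = (fst c, merge \<sigma> T (snd c))"
      using Suc by (auto simp: c_def Let_def)
    then show ?case
      using embed_step(1)[OF assms(2,3), of "fst c" "snd c" T] valid_step[OF assms(1), of c]
      by (simp add: Let_def flip: c_def)
  qed
  then show ?thesis
    using run embed_step(2)[OF assms(2,3), of _ U T] T assms(4)
    by (auto simp: runs_def Let_def prod_eq_iff) (metis prod.collapse)+
qed

end

section \<open>Composing a machine, a finite table and another machine\<close>

lemma set_str: "set (str w) \<subseteq> range Letter"
  by (auto simp: str_def)

lemma set_unary: "set (unary n) \<subseteq> {Tick}"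
  by (auto simp: unary_def)

lemma length_str [simp]: "length (str w) = length w"
  by (simp add: str_def)

lemma length_unary [simp]: "length (unary n) = n"
  by (simp add: unary_def)

lemma str_Nil [simp]: "str [] = []"
  by (simp add: str_def)

lemma unary_0 [simp]: "unary 0 = []"
  by (simp add: unary_def)

lemma inj_str: "inj str"
  by (auto simp: str_def intro!: injI dest: map_injective[OF _ injI])

lemma input_symbols [simp]:
  "set (str w) \<subseteq> alphabet M" "set (unary n) \<subseteq> alphabet M"
  using set_str[of w] set_unary[of n] by (auto simp: alphabet_def)

lemma no_Blank [simp]: "Blank \<notin> set (str w)" "Blank \<notin> set (unary n)"
  using set_str[of w] set_unary[of n] by auto

text \<open>
  The composed machine keeps its input on tapes 0 and 1 for \<open>L\<close> and runs \<open>R\<close> on copies of it, on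
  the odd tapes from 3 on. The table value is written to tape 4. The output tape 5 of \<open>L\<close> becomes
  tape 2, and the work tapes of \<open>L\<close> become the even tapes from 12 on.
\<close>

lemma compose_with_table:
  fixes R L :: "('a::finite) tm" and f :: "'a list \<Rightarrow> nat \<Rightarrow> 'a list" and c :: nat
  assumes R: "is_tm R" and L: "is_tm L"
    and f: "\<And>I' k'. length (f I' k') \<le> length I' + k'"
  obtains M C where "is_tm M"
    and "\<And>I k I' k' s tR tL.
      computes_within R [str I, unary k] [str I', unary k'] tR \<Longrightarrow> length I' + k' \<le> c \<Longrightarrow>
      computes_within L [str I, unary k, str I', unary k', str (f I' k')] [str s] tL \<Longrightarrow>
      computes_within M [str I, unary k] [str s] (9 * (length I + k) + C + tR + tL)"
proof -
  define n where "n = 2 * (ntapes R + ntapes L) + 12"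
  define a where "a = naux R + naux L"
  \<comment> \<open>\<open>\<rho>\<close> puts the outputs of \<open>R\<close>, its tapes 2 and 3,
    on tapes 7 and 9, where \<open>\<sigma>\<close> looks for the inputs 2 and 3 of
    \<open>L\<close>. Apart from these two tapes the ranges are disjoint.\<close>
  define \<rho> where "\<rho> = (\<lambda>i::nat. 2 * i + 3)"
  define \<sigma> where "\<sigma> = (\<lambda>i::nat. if i = 2 then 7 else if i = 3 then 9 else if i = 5 then 2
    else if i < 6 then i else 2 * i)"
  obtain xs :: "'a sym list" where xs: "set xs = insert Tick (range Letter)"
    using finite_list[of "insert Tick (range Letter)"] finite_imageI[OF finite_UNIV, of Letter] by blast
  \<comment> \<open>The table is indexed by tape contents: \<open>inv str\<close> recovers the
    instance and the length of a unary string the parameter. Strings of another form get an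
    arbitrary entry, which is still a word over the input alphabet and can thus be written.\<close>
  define g where "g v w = str (f (inv str v) (length w))" for v w :: "'a sym list"
  define lookup where "lookup = read_tm n a 7 xs c (\<lambda>v. read_tm n a 9 xs c (\<lambda>w. write_tm n a 4 (g v w)))"
  define M7 where "M7 = seq_tm n a (rewind_tm n a 4) (embed_tm n a \<sigma> L)"
  define M6 where "M6 = seq_tm n a (rewind_tm n a 9) M7"
  define M5 where "M5 = seq_tm n a (rewind_tm n a 7) M6"
  define M4 where "M4 = seq_tm n a lookup M5"
  define M3 where "M3 = seq_tm n a (embed_tm n a \<rho> R) M4"
  define M2 where "M2 = seq_tm n a (copy_tm n a 1 5) M3"
  define M where "M = seq_tm n a (copy_tm n a 0 3) M2"
  have inj: "inj \<rho>" "inj \<sigma>"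
    by (auto simp: \<rho>_def \<sigma>_def inj_def split: if_splits) 
  have bound: "\<forall>i < ntapes R. \<rho> i < n" "\<forall>i < ntapes L. \<sigma> i < n"
    by (auto simp: \<rho>_def \<sigma>_def n_def)
  have small: "0 < n" "1 < n" "3 < n" "4 < n" "5 < n" "7 < n" "9 < n"
    by (auto simp: n_def)
  have pw: "program n a (write_tm n a 4 (g v w))" for v w
    using set_str[of "f (inv str v) (length w)"] by (intro program_write) (auto simp: g_def)
  have plookup: "program n a lookup"
    unfolding lookup_def using pw by (intro program_read)
  have pR: "program n a (embed_tm n a \<rho> R)" and pL: "program n a (embed_tm n a \<sigma> L)"
    using R L inj by (auto intro!: program_embed simp: a_def)
  have p7: "program n a M7" unfolding M7_def using pL by auto
  have p6: "program n a M6" unfolding M6_def using p7 by auto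
  have p5: "program n a M5" unfolding M5_def using p6 by auto
  have p4: "program n a M4" unfolding M4_def using p5 plookup by auto
  have p3: "program n a M3" unfolding M3_def using p4 pR by auto
  have p2: "program n a M2" unfolding M2_def using p3 by auto
  have p1: "program n a M" unfolding M_def using p2 by auto
  \<comment> \<open>39 = 2 * 10 + 3 * 4 + 7 accounts for two copies, three rewinds and seven
    transfers of control. The other terms generously bound reading, writing and rewinding strings of
    length at most \<open>c\<close>.\<close>
  define C where "C = 2 * ((length xs + 2) * c) + 11 * c + 39"
  show thesis
  proof (rule that[of M C])
    show "is_tm M" using p1 by (rule program_is_tm)
  next
    fix I :: "'a list" and k :: nat and I' k' s tR tL
    assume cR: "computes_within R [str I, unary k] [str I', unary k'] tR"
      and le: "length I' + k' \<le> c"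
      and cL: "computes_within L [str I, unary k, str I', unary k', str (f I' k')] [str s] tL"
    define s' where "s' = f I' k'"
    let ?in = "[str I, unary k]" and ?in' = "[str I, unary k, str I', unary k', str s']"
    define T0 where "T0 = snd (init ?in)"
    have T0: "T0 0 = tape_of (str I)" "T0 1 = tape_of (unary k)" "\<And>i. 2 \<le> i \<Longrightarrow> T0 i = tape_of []"
      by (auto simp: T0_def init_def nth_Cons')
    define T2 where "T2 = T0(3 := tape_of (str I), 5 := tape_of (unary k))"
    have r1: "runs (copy_tm n a 0 3) T0 (T0(3 := tape_of (str I))) (9 * length I + 10)"
      using runs_copy[OF small(1,3), of T0 "str I" a] T0 by simp
    have r2: "runs (copy_tm n a 1 5) (T0(3 := tape_of (str I))) T2 (9 * k + 10)"
      using runs_copy[OF small(2,5), of "T0(3 := tape_of (str I))" "unary k" a] T0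
      by (simp add: T2_def)
    obtain U where U: "runs R T0 U tR" "U 2 = tape_of (str I')" "U 3 = tape_of (unary k')"
    proof -
      obtain U where U: "runs R T0 U tR"
        "\<And>j. j < 2 \<Longrightarrow> U (2 + j) = tape_of ([str I', unary k'] ! j)"
        using cR unfolding computes_within_iff_runs T0_def by (auto simp: numeral_2_eq_2)
      show thesis
        using that[OF U(1)] U(2)[of 0] U(2)[of 1] by simp
    qed
    define T3 where "T3 = merge \<rho> T2 U"
    have "T2 \<circ> \<rho> = snd (init ?in)"
      by (rule ext) (auto simp: T2_def \<rho>_def T0 init_def nth_Cons')
    then have r3: "runs (embed_tm n a \<rho> R) T2 T3 tR"
      unfolding T3_def using R inj(1) bound(1) U(1)
      by (intro runs_embed[where xss = ?in]) (auto simp: T0_def)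
    have T3: "T3 7 = tape_of (str I')" "T3 9 = tape_of (unary k')"
      using merge_image[OF inj(1), of T2 U 2] merge_image[OF inj(1), of T2 U 3] U
      by (auto simp: T3_def \<rho>_def)
    \<comment> \<open>\<open>\<rho>\<close> hits only odd tapes from 3 on, so \<open>R\<close>
      spoils neither the input kept for \<open>L\<close> nor the tapes on which \<open>L\<close>
      needs blanks.\<close>
    have T3': "T3 j = T0 j" if "even j \<or> j = 1" for j
    proof -
      have "j \<notin> range \<rho>" using that by (auto simp: \<rho>_def) 
      then have "T3 j = T2 j" by (simp add: T3_def merge_outside)
      then show ?thesis using that by (auto simp: T2_def)
    qed
    have g: "g (str I') (unary k') = str s'"
      by (simp add: g_def s'_def inv_f_f[OF inj_str])
    have len: "length s' \<le> c" using f[of I' k'] le by (simp add: s'_def)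
    let ?T4a = "T3(7 := tape_at (int (length I')) (str I'))"
    let ?T4b = "?T4a(9 := tape_at (int k') (unary k'))"
    define T4 where "T4 = ?T4b(4 := tape_at (int (length s')) (str s'))"
    have w: "runs (write_tm n a 4 (g (str I') (unary k'))) ?T4b T4 (2 * length s')"
      unfolding g T4_def
      using runs_write[OF small(4), of "str s'" ?T4b "[]" a] set_str[of s'] T3'[of 4] T0
      by (auto simp: tape_at_0 simp del: fun_upd_apply simp add: fun_upd_same fun_upd_other)
    have "runs (read_tm n a 9 xs c (\<lambda>w. write_tm n a 4 (g (str I') w))) ?T4a T4
        (2 * length s' + (length xs + 2) * c)"
      using w pw le T3 set_unary[of k'] xs small
      by (intro runs_read[where w = "unary k'" and ys = "[]"]) (auto simp: tape_at_0)
    then have "runs lookup T3 T4 (2 * length s' + (length xs + 2) * c + (length xs + 2) * c)"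
      unfolding lookup_def using pw le T3 set_str[of I'] xs small
      by (intro runs_read[where i = 7 and w = "str I'" and ys = "[]"])
        (auto simp: tape_at_0 intro: program_read)
    then have r4: "runs lookup T3 T4 (2 * c + 2 * ((length xs + 2) * c))"
      by (rule runs_mono) (use len in simp)
    \<comment> \<open>The lookup leaves the heads of tapes 7, 9 and 4 behind their strings, but
      \<open>L\<close> expects them on the first cell.\<close>
    define T5 where "T5 = T3(4 := tape_of (str s'))"
    let ?T7 = "T4(7 := tape_of (str I'))"
    let ?T9 = "?T7(9 := tape_of (unary k'))"
    have r5: "runs (rewind_tm n a 7) T4 ?T7 (3 * length I' + 4)"
      using runs_rewind[OF small(6), of T4 "str I'" a] by (simp add: T4_def)
    have r6: "runs (rewind_tm n a 9) ?T7 ?T9 (3 * k' + 4)"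
      using runs_rewind[OF small(7), of ?T7 "unary k'" a] by (simp add: T4_def)
    have "?T9(4 := tape_of (str s')) = T5"
      using T3 by (auto simp: T4_def T5_def fun_eq_iff)
    then have r7: "runs (rewind_tm n a 4) ?T9 T5 (3 * length s' + 4)"
      using runs_rewind[OF small(4), of ?T9 "str s'" a] by (simp add: T4_def)
    obtain V where V: "runs L (snd (init ?in')) V tL" "V 5 = tape_of (str s)"
      using cL by (auto simp: computes_within_iff_runs s'_def eval_nat_numeral)
    have in': "snd (init ?in') 0 = tape_of (str I)" "snd (init ?in') 1 = tape_of (unary k)"
      "snd (init ?in') 2 = tape_of (str I')" "snd (init ?in') 3 = tape_of (unary k')"
      "snd (init ?in') 4 = tape_of (str s')" "\<And>i. 5 \<le> i \<Longrightarrow> snd (init ?in') i = tape_of []"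
      by (simp_all add: init_def eval_nat_numeral)
    have "T5 (\<sigma> i) = snd (init ?in') i" for i
    proof -
      consider "i = 0" | "i = 1" | "i = 2" | "i = 3" | "i = 4" | "i = 5" | "6 \<le> i" by linarith
      then show ?thesis
        by cases (simp_all add: \<sigma>_def T5_def T3 T3' T0 in' del: One_nat_def)
    qed
    then have r8: "runs (embed_tm n a \<sigma> L) T5 (merge \<sigma> T5 V) tL"
      using L inj(2) bound(2) V(1)
      by (intro runs_embed[where xss = ?in']) (auto simp: fun_eq_iff)
    have "runs M T0 (merge \<sigma> T5 V) (9 * length I + 10 + (9 * k + 10 + (tR + (2 * c + 2 * ((length xs + 2) * c)
        + (3 * length I' + 4 + (3 * k' + 4 + (3 * length s' + 4 + tL + 1) + 1) + 1) + 1) + 1) + 1) + 1)"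
      unfolding M_def M2_def M3_def M4_def M5_def M6_def M7_def
      by (intro runs_seq[OF _ _ r1] runs_seq[OF _ _ r2] runs_seq[OF _ _ r3] runs_seq[OF _ _ r4]
          runs_seq[OF _ _ r5] runs_seq[OF _ _ r6] runs_seq[OF _ _ r7] r8 program_seq program_copy
          program_rewind pR pL plookup)
    then have "runs M T0 (merge \<sigma> T5 V) (9 * (length I + k) + C + tR + tL)"
      by (rule runs_mono) (use len le in \<open>simp add: C_def\<close>)
    moreover have "merge \<sigma> T5 V 2 = tape_of (str s)"
      using merge_image[OF inj(2), of T5 V 5] V(2) by (simp add: \<sigma>_def)
    ultimately show "computes_within M ?in [str s] (9 * (length I + k) + C + tR + tL)"
      unfolding computes_within_iff_runs T0_def by (intro exI[of _ "merge \<sigma> T5 V"]) (simp add: numeral_2_eq_2)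
  qed
qed

lemma computes_within_mono:
  "computes_within M xss yss t \<Longrightarrow> t \<le> t' \<Longrightarrow> computes_within M xss yss t'"
  unfolding computes_within_iff_runs using runs_mono by metis

text \<open>The coefficients are natural numbers, so every term is monotone.\<close>

lemma poly_nat_mono:
  fixes p :: "nat poly"
  assumes "x \<le> y"
  shows "poly p x \<le> poly p y"
  using assms by (induction p) (auto intro!: add_mono mult_mono)

section \<open>Approximation ratios\<close>

lemma finite_solutions [simp]: "finite (solutions I k :: ('a::finite) list set)"
  using finite_lists_length_le[of "UNIV :: 'a set"] by (simp add: solutions_def)

lemma Nil_solution: "[] \<in> solutions I k"
  by (simp add: solutions_def)

text \<open>Over a finite alphabet there are finitely many solutions, and the empty word is always
  one, so \<open>Min\<close> and \<open>Max\<close> are attained.\<close>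

lemma optimal_solution_exists:
  obtains s where "s \<in> solutions I k" "\<Pi> I k s = OPT g \<Pi> I k"
proof -
  have "\<Pi> I k ` solutions I k \<noteq> {}" using Nil_solution by auto
  then have "OPT g \<Pi> I k \<in> \<Pi> I k ` solutions I k"
    unfolding OPT_def by (cases g) (auto simp del: image_is_empty)
  then show thesis using that by auto
qed

text \<open>The degenerate optima fit the conventions: for \<open>opt = 0 < v\<close> the quotient
  is infinite and \<open>\<alpha> * opt\<close> is 0, so both sides fail;
  \<open>opt = \<infinity>\<close> forces \<open>v = opt\<close>, where
  \<open>1 \<le> \<alpha>\<close> makes both sides true.\<close>

lemma ratio_le_iff:
  fixes opt v :: ereal
  assumes "0 \<le> opt" "opt \<le> v" "1 \<le> \<alpha>"
  shows "(if v = opt then 1 else v / opt) \<le> ereal \<alpha> \<longleftrightarrow> v \<le> ereal \<alpha> * opt"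
proof (cases "v = opt")
  case True
  then show ?thesis
    using assms by (cases opt) (auto simp: one_ereal_def mult_le_cancel_right1)
next
  case False
  then show ?thesis
    using assms by (cases opt; cases v) (auto simp: divide_simps zero_ereal_def)
qed

text \<open>If \<open>v < opt\<close>, then for \<open>opt = 0\<close> the quotient is
  \<open>- \<infinity>\<close> and for \<open>opt = \<infinity>\<close> it is 0, so both sides fail;
  \<open>opt = - \<infinity>\<close> forces \<open>v = opt\<close>.\<close>

lemma ratio_ge_iff:
  fixes opt v :: ereal
  assumes "0 \<le> opt \<or> opt = - \<infinity>" "v \<le> opt" "1 \<le> \<alpha>"
  shows "1 \<le> (if v = opt then 1 else v / opt) * ereal \<alpha> \<longleftrightarrow> opt \<le> ereal \<alpha> * v"
proof (cases "v = opt")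
  case True
  then show ?thesis
    using assms by (cases opt) (auto simp: one_ereal_def mult_le_cancel_right1)
next
  case False
  then show ?thesis
    using assms
    by (cases opt; cases v) (auto simp: divide_simps zero_ereal_def one_ereal_def mult.commute zero_le_mult_iff)
qed

text \<open>Serves both directions: from right to left it certifies the lifting algorithm of the
  empty kernel, from left to right the lifted table entry. Passing between quotient and product
  relies on \<open>s\<close> being no better than the optimum, as it is a solution.\<close>

lemma lift_guarantee_optimal:
  assumes "1 \<le> \<alpha>" "nonneg_optimum g \<Pi>" "s \<in> solutions I k" "\<Pi> I' k' s' = OPT g \<Pi> I' k'"
  shows "lift_guarantee \<alpha> g \<Pi> I k s I' k' s' \<longleftrightarrow> approx_solution \<alpha> g \<Pi> I k s"
proof -
  have r': "ratio g \<Pi> I' k' s' = 1" using assms(4) by (simp add: ratio_def)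
  have opt: "0 \<le> OPT g \<Pi> I k \<or> g = Maximize \<and> OPT g \<Pi> I k = - \<infinity>"
    using assms(2) by (simp add: nonneg_optimum_def)
  show ?thesis
  proof (cases g)
    case Minimize
    have "OPT g \<Pi> I k \<le> \<Pi> I k s" using assms(3) by (simp add: OPT_def Minimize)
    then have "ratio g \<Pi> I k s \<le> ereal \<alpha> \<longleftrightarrow> \<Pi> I k s \<le> ereal \<alpha> * OPT g \<Pi> I k"
      unfolding ratio_def using opt assms(1) Minimize by (intro ratio_le_iff) auto
    then show ?thesis
      using assms(3) r' by (simp add: lift_guarantee_def approx_solution_def Minimize)
  next
    case Maximize
    have "\<Pi> I k s \<le> OPT g \<Pi> I k" using assms(3) by (simp add: OPT_def Maximize)
    then have "1 \<le> ratio g \<Pi> I k s * ereal \<alpha> \<longleftrightarrow> OPT g \<Pi> I k \<le> ereal \<alpha> * \<Pi> I k s"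
      unfolding ratio_def using opt assms(1) by (intro ratio_ge_iff) auto
    then show ?thesis
      using assms(3) r' by (simp add: lift_guarantee_def approx_solution_def Maximize)
  qed
qed

section \<open>The two directions of the equivalence\<close>

lemma kernel_of_approximation:
  assumes \<alpha>: "1 \<le> \<alpha>" and nn: "nonneg_optimum g \<Pi>" and "has_polytime_approximation \<alpha> g \<Pi>"
  shows "has_constant_size_approx_kernel \<alpha> g (\<Pi> :: ('a::finite) problem)"
proof -
  obtain M p where M: "is_tm M" and run: "\<And>I k. \<exists>s.
      computes_within M [str I, unary k] [str s] (poly p (length I + k)) \<and> approx_solution \<alpha> g \<Pi> I k s"
    using assms(3) unfolding has_polytime_approximation_def by blast
  define red :: "'a list \<Rightarrow> nat \<Rightarrow> 'a list \<times> nat" where "red I k = ([], 0)" for I k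
  \<comment> \<open>\<open>L\<close> has five input tapes and \<open>M\<close> only two. Skipping
    tapes 2 to 4 sends the output tape 2 of \<open>M\<close> to tape 5, the output tape of
    \<open>L\<close>.\<close>
  define \<sigma> where "\<sigma> = (\<lambda>i::nat. if i < 2 then i else i + 3)"
  define n where "n = ntapes M + 3"
  define L where "L = embed_tm n (naux M) \<sigma> M"
  have inj: "inj \<sigma>" by (auto simp: \<sigma>_def inj_def split: if_splits)
  have sol: "solutions [] 0 = {[] :: 'a list}" by (auto simp: solutions_def)
  \<comment> \<open>A machine that halts at once leaves its output tapes blank, and blank tapes
    already encode the empty word and the number 0.\<close>
  have "computes_within (skip_tm 0 0) [str I, unary k] [str [], unary 0] (poly 0 (length I + k))" for I :: "'a list" and k
    unfolding computes_within_iff_runs using runs_skip[of 0 0 "snd (init [str I, unary k])"]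
    by (intro exI[of _ "snd (init [str I, unary k])"]) (auto simp: init_def less_Suc_eq)
  then have "polytime_reduction (skip_tm 0 0) red"
    using program_is_tm[OF program_skip] unfolding polytime_reduction_def red_def by blast
  moreover have "polytime_solution_lifting \<alpha> g \<Pi> L red"
    unfolding polytime_solution_lifting_def
  proof (intro conjI exI[of _ p] allI)
    have "program n (naux M) L" unfolding L_def using M inj by (intro program_embed) auto
    then show "is_tm L" by (rule program_is_tm)
  next
    fix I :: "'a list" and k :: nat
    let ?in = "[str I, unary k, [], [], []]"
    obtain s where s: "computes_within M [str I, unary k] [str s] (poly p (length I + k))"
      "approx_solution \<alpha> g \<Pi> I k s"
      using run by blast
    then obtain U where U: "runs M (snd (init [str I, unary k])) U (poly p (length I + k))"
      "U 2 = tape_of (str s)"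
      by (auto simp: computes_within_iff_runs numeral_2_eq_2)
    let ?T = "snd (init ?in)"
    have "?T \<circ> \<sigma> = snd (init [str I, unary k])"
      by (rule ext) (auto simp: init_def \<sigma>_def nth_Cons')
    then have "runs L ?T (merge \<sigma> ?T U) (poly p (length I + k))"
      unfolding L_def using M inj U(1)
      by (intro runs_embed[where xss = "[str I, unary k]"]) (auto simp: \<sigma>_def n_def)
    moreover have "merge \<sigma> ?T U 5 = tape_of (str s)"
      using merge_image[OF inj, of ?T U 2] U(2) by (simp add: \<sigma>_def)
    ultimately have "computes_within L ?in [str s] (poly p (length I + k))"
      unfolding computes_within_iff_runs by (intro exI[of _ "merge \<sigma> ?T U"]) (simp add: eval_nat_numeral)
    moreover have "s \<in> solutions I k" using s(2) by (simp add: approx_solution_def)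
    moreover have "\<Pi> [] 0 [] = OPT g \<Pi> [] 0"
      by (cases g) (simp_all add: OPT_def sol)
    ultimately show "case red I k of (I', k') \<Rightarrow> \<forall>s' \<in> solutions I' k'. \<exists>s \<in> solutions I k.
          computes_within L [str I, unary k, str I', unary k', str s'] [str s]
            (poly p (length I + k + length I' + k' + length s')) \<and>
          lift_guarantee \<alpha> g \<Pi> I k s I' k' s'"
      using s(2) lift_guarantee_optimal[OF \<alpha> nn, of s I k "[]" 0 "[]"] by (auto simp: red_def sol)
  qed
  moreover have "preprocessing_size red k \<le> enat 0" for k
    by (simp add: preprocessing_size_def red_def)
  ultimately show ?thesis
    unfolding has_constant_size_approx_kernel_def approx_preprocessing_def by blast
qed

lemma approximation_of_kernel:
  assumes \<alpha>: "1 \<le> \<alpha>" and nn: "nonneg_optimum g \<Pi>" and "has_constant_size_approx_kernel \<alpha> g \<Pi>"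
  shows "has_polytime_approximation \<alpha> g (\<Pi> :: ('a::finite) problem)"
proof -
  obtain R L red c where R: "polytime_reduction R red" and L: "polytime_solution_lifting \<alpha> g \<Pi> L red"
    and size: "\<And>k. preprocessing_size red k \<le> enat c"
    using assms(3) unfolding has_constant_size_approx_kernel_def approx_preprocessing_def by blast
  obtain p where tmR: "is_tm R" and p: "\<And>I k. case red I k of (I', k') \<Rightarrow>
        computes_within R [str I, unary k] [str I', unary k'] (poly p (length I + k))"
    using R unfolding polytime_reduction_def by blast
  obtain q where tmL: "is_tm L" and q: "\<And>I k. case red I k of (I', k') \<Rightarrow>
        \<forall>s' \<in> solutions I' k'. \<exists>s \<in> solutions I k.
          computes_within L [str I, unary k, str I', unary k', str s'] [str s]
            (poly q (length I + k + length I' + k' + length s')) \<and>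
          lift_guarantee \<alpha> g \<Pi> I k s I' k' s'"
    using L unfolding polytime_solution_lifting_def by blast
  have "\<exists>s. s \<in> solutions I k \<and> \<Pi> I k s = OPT g \<Pi> I k" for I k
    using optimal_solution_exists by metis
  then obtain f where f: "\<And>I k. f I k \<in> solutions I k" "\<And>I k. \<Pi> I k (f I k) = OPT g \<Pi> I k"
    by metis
  have flen: "length (f I k) \<le> length I + k" for I k
    using f(1)[of I k] by (simp add: solutions_def)
  obtain M C where M: "is_tm M"
    and run: "\<And>I k I' k' s tR tL.
      computes_within R [str I, unary k] [str I', unary k'] tR \<Longrightarrow> length I' + k' \<le> c \<Longrightarrow>
      computes_within L [str I, unary k, str I', unary k', str (f I' k')] [str s] tL \<Longrightarrow>
      computes_within M [str I, unary k] [str s] (9 * (length I + k) + C + tR + tL)"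
    using compose_with_table[OF tmR tmL, of f c] flen by metis
  \<comment> \<open>\<open>[:C, 9:]\<close> pays for copying the input and for the table,
    \<open>p\<close> for \<open>R\<close>. In the time bound of \<open>L\<close>, the reduced
    instance and its table entry contribute at most \<open>c\<close> each, hence the shift of the
    argument by \<open>2 * c\<close>.\<close>
  let ?p = "[:C, 9:] + p + pcompose q [:2 * c, 1:]"
  have "\<exists>s. computes_within M [str I, unary k] [str s] (poly ?p (length I + k)) \<and>
      approx_solution \<alpha> g \<Pi> I k s" for I k
  proof -
    obtain I' k' where red: "red I k = (I', k')" by fastforce
    have "enat (length I' + k') \<le> preprocessing_size red k"
      unfolding preprocessing_size_def using red by (intro SUP_upper2[of I]) auto
    then have le: "length I' + k' \<le> c" using size[of k] order_trans by fastforce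
    obtain s where s: "s \<in> solutions I k" "lift_guarantee \<alpha> g \<Pi> I k s I' k' (f I' k')"
      "computes_within L [str I, unary k, str I', unary k', str (f I' k')] [str s]
        (poly q (length I + k + length I' + k' + length (f I' k')))"
      using q[of I k] f(1)[of I' k'] red by auto
    have "poly q (length I + k + length I' + k' + length (f I' k')) \<le> poly q (2 * c + (length I + k))"
      using flen[of I' k'] le by (intro poly_nat_mono) simp
    then have "computes_within L [str I, unary k, str I', unary k', str (f I' k')] [str s]
        (poly q (2 * c + (length I + k)))"
      using s(3) computes_within_mono by blast
    then have "computes_within M [str I, unary k] [str s]
        (9 * (length I + k) + C + poly p (length I + k) + poly q (2 * c + (length I + k)))"
      using p[of I k] red le by (intro run) auto
    then have "computes_within M [str I, unary k] [str s] (poly ?p (length I + k))"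
      by (rule computes_within_mono) (simp add: poly_pcompose)
    moreover have "approx_solution \<alpha> g \<Pi> I k s"
      using lift_guarantee_optimal[OF \<alpha> nn s(1) f(2)] s(2) by blast
    ultimately show ?thesis by blast
  qed
  then show ?thesis
    unfolding has_polytime_approximation_def using M by blast
qed

theorem theorem3p12:
  fixes \<alpha> :: real and g :: goal and \<Pi> :: "('a::finite) problem"
  assumes "\<alpha> \<ge> 1"
    and "computable_problem \<Pi>"
    and "decidable g \<Pi>"
    and "nonneg_optimum g \<Pi>"
  shows "has_polytime_approximation \<alpha> g \<Pi> \<longleftrightarrow> has_constant_size_approx_kernel \<alpha> g \<Pi>"
  using kernel_of_approximation approximation_of_kernel assms(1,4) by blast

end
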